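(* Let $f,g:[a,b]\to\mathbb{R}$ be functions and $0<\alpha\le1$. Then $$\int_a^b (I_\alpha^a f)(t)\,g(t)\,d_\alpha(b,t)=\int_a^b f(t)\,({}^{b}I_\alpha g)(t)\,d_\alpha(t,a).$$
   Context: For $0<\alpha\le1$, the left and right conformable fractional integrals of order $\alpha$ are $$(I_\alpha^a f)(t)=\int_a^t (x-a)^{\alpha-1}f(x)\,dx,\qquad ({}^{b}I_\alpha g)(t)=\int_t^b (b-x)^{\alpha-1}g(x)\,dx .$$ The notations $d_\alpha(t,a)$ and $d_\alpha(b,t)$ mean $(t-a)^{\alpha-1}dt$ and $(b-t)^{\alpha-1}dt$, respectively. *)

theory Defs
  imports "HOL-Analysis.Analysis"
begin

text \<open>
  All integrals are Henstock--Kurzweil integrals, so that Riemann, improper Riemann and Lebesgue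
  integrals over compact intervals are covered. The weights are singular at an endpoint when
  \<open>\<alpha> < 1\<close>; the value \<open>0 powr c = 0\<close> that they take there affects only a null set (also for
  \<open>\<alpha> = 1\<close>, where the weight is 1 at every other point). The operators are meant for
  \<open>a \<le> t\<close> and \<open>t \<le> b\<close>, respectively.
\<close>

definition left_conf_integral :: "real \<Rightarrow> real \<Rightarrow> (real \<Rightarrow> real) \<Rightarrow> real \<Rightarrow> real" where
  "left_conf_integral \<alpha> a f t = integral {a..t} (\<lambda>x. (x - a) powr (\<alpha> - 1) * f x)"

definition right_conf_integral :: "real \<Rightarrow> real \<Rightarrow> (real \<Rightarrow> real) \<Rightarrow> real \<Rightarrow> real" where
  "right_conf_integral \<alpha> b g t = integral {t..b} (\<lambda>x. (b - x) powr (\<alpha> - 1) * g x)"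

end

theory Submission
  imports Defs
begin

text \<open>
  Put \<open>u x = (x - a)\<^sup>\<alpha>\<^sup>-\<^sup>1 f x\<close>, \<open>v x = (b - x)\<^sup>\<alpha>\<^sup>-\<^sup>1 g x\<close>, \<open>F t = \<integral>\<^sub>a\<^sup>t u\<close> and \<open>G t = \<integral>\<^sub>t\<^sup>b v\<close>. Formally
  \<open>(F G)' = u G - F v\<close>, and \<open>F G\<close> vanishes at both endpoints, so the claim is integration by parts.
  Neither \<open>u G\<close> nor \<open>F v\<close> need be Henstock--Kurzweil integrable, but their difference always is,
  with integral 0. Hence either both are integrable, with equal integrals, or neither is, and
  then both integrals are 0 by convention.
\<close>

text \<open>Up to the constant \<open>F a\<close>, \<open>F\<close> is the indefinite integral of
  \<open>u\<close>. Being a primitive is expressed through increments over subintervals, since a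
  Henstock--Kurzweil primitive need not have derivative \<open>u\<close> at every point.\<close>

lemma has_integral_imp_continuous_on_primitive:
  fixes F u :: "real \<Rightarrow> real"
  assumes "\<And>x y. a \<le> x \<Longrightarrow> x \<le> y \<Longrightarrow> y \<le> b \<Longrightarrow> (u has_integral F y - F x) {x..y}"
  shows "continuous_on {a..b} F"
proof (cases "a \<le> b")
  case True
  have "continuous_on {a..b} (\<lambda>x. F a + integral {a..x} u)"
    using assms[of a b] True
    by (intro continuous_intros indefinite_integral_continuous_1) auto
  moreover have "F x = F a + integral {a..x} u" if "x \<in> {a..b}" for x
    using integral_unique[OF assms[of a x]] that by simp
  ultimately show ?thesis
    by (metis (no_types, lifting) continuous_on_cong)
qed simp

text \<open>Henstock's lemma with the integral over each piece rewritten as an increment of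
  \<open>F\<close>. The absolute values inside the sum matter: the errors are later multiplied by
  factors that vary from piece to piece.\<close>

lemma Henstock_lemma_primitive:
  fixes F u :: "real \<Rightarrow> real"
  assumes F: "\<And>x y. a \<le> x \<Longrightarrow> x \<le> y \<Longrightarrow> y \<le> b \<Longrightarrow> (u has_integral F y - F x) {x..y}"
    and "a \<le> b" "e > 0"
  obtains \<gamma> where "gauge \<gamma>"
    "\<And>D. D tagged_division_of {a..b} \<Longrightarrow> \<gamma> fine D \<Longrightarrow>
       (\<Sum>(t,K)\<in>D. \<bar>F (Sup K) - F (Inf K) - measure lborel K * u t\<bar>) < e"
proof -
  have "u integrable_on cbox a b"
    using F[of a b] \<open>a \<le> b\<close> by auto
  from Henstock_lemma[OF this \<open>e > 0\<close>] obtain \<gamma> where \<gamma>: "gauge \<gamma>"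
    "\<And>D. D tagged_partial_division_of cbox a b \<Longrightarrow> \<gamma> fine D \<Longrightarrow>
       (\<Sum>(t,K)\<in>D. norm (measure lborel K *\<^sub>R u t - integral K u)) < e"
    by blast
  show thesis
  proof (rule that[OF \<gamma>(1)])
    fix D assume D: "D tagged_division_of {a..b}" and fine: "\<gamma> fine D"
    have "\<bar>F (Sup K) - F (Inf K) - measure lborel K * u t\<bar> = norm (measure lborel K *\<^sub>R u t - integral K u)"
      if tK: "(t, K) \<in> D" for t K
    proof -
      obtain c d where K: "K = {c..d}"
        using tagged_division_ofD(4)[OF D tK] by auto
      have "t \<in> K" "K \<subseteq> {a..b}"
        using tagged_division_ofD(2,3)[OF D tK] by auto
      then have "a \<le> c" "c \<le> d" "d \<le> b"
        using K by auto
      then show ?thesis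
        using integral_unique[OF F[of c d]] K by simp
    qed
    then have "(\<Sum>(t,K)\<in>D. \<bar>F (Sup K) - F (Inf K) - measure lborel K * u t\<bar>) =
               (\<Sum>(t,K)\<in>D. norm (measure lborel K *\<^sub>R u t - integral K u))"
      by (intro sum.cong) auto
    also have "\<dots> < e"
      using \<gamma>(2)[OF _ fine] D by (simp add: tagged_division_of_def)
    finally show "(\<Sum>(t,K)\<in>D. \<bar>F (Sup K) - F (Inf K) - measure lborel K * u t\<bar>) < e" .
  qed
qed

text \<open>
  Over an interval \<open>[c, d]\<close> with tag \<open>t\<close>, write the increment of \<open>F G\<close> as
  \<open>(F d - F c) G d + F c (G d - G c)\<close>. Henstock's lemma controls the replacement of the two
  increments by \<open>u t (d - c)\<close> and \<open>v t (d - c)\<close>; a gauge depending on \<open>u t\<close> and \<open>v t\<close>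
  controls the replacement of \<open>G d\<close> and \<open>F c\<close> by \<open>G t\<close> and \<open>F t\<close>.
\<close>
theorem has_integral_by_parts_primitives:
  fixes F G u v :: "real \<Rightarrow> real"
  assumes "a \<le> b"
    and F: "\<And>x y. a \<le> x \<Longrightarrow> x \<le> y \<Longrightarrow> y \<le> b \<Longrightarrow> (u has_integral F y - F x) {x..y}"
    and G: "\<And>x y. a \<le> x \<Longrightarrow> x \<le> y \<Longrightarrow> y \<le> b \<Longrightarrow> (v has_integral G y - G x) {x..y}"
  shows "((\<lambda>t. u t * G t + F t * v t) has_integral F b * G b - F a * G a) {a..b}"
  unfolding has_integral_real
proof (intro allI impI)
  fix e :: real assume "e > 0"
  note contF = has_integral_imp_continuous_on_primitive[OF F]
  note contG = has_integral_imp_continuous_on_primitive[OF G]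
  \<comment> \<open>\<open>M\<close> bounds the factors \<open>G d\<close> and \<open>F c\<close>
    that multiply the two increment errors.\<close>
  obtain M where "M > 0" and M: "\<And>x. x \<in> {a..b} \<Longrightarrow> \<bar>F x\<bar> \<le> M" "\<And>x. x \<in> {a..b} \<Longrightarrow> \<bar>G x\<bar> \<le> M"
  proof -
    have "bounded (F ` {a..b} \<union> G ` {a..b})"
      using contF contG by (auto intro!: compact_imp_bounded compact_continuous_image)
    then obtain M where "M > 0" "\<forall>y \<in> F ` {a..b} \<union> G ` {a..b}. norm y \<le> M"
      by (auto simp: bounded_pos)
    then show thesis
      using that[of M] by auto
  qed
  \<comment> \<open>The error budget is \<open>e / 4\<close> for each use of Henstock's lemma and
    \<open>e / 2\<close> for the two continuity errors, at most \<open>2 * \<eta> * (b - a)\<close>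
    together. The summand 1 avoids division by 0 when \<open>a = b\<close>.\<close>
  define \<eta> where "\<eta> = e / (4 * (b - a + 1))"
  have "\<eta> > 0"
    using \<open>e > 0\<close> \<open>a \<le> b\<close> by (simp add: \<eta>_def)
  have "e / (4 * M) > 0"
    using \<open>e > 0\<close> \<open>M > 0\<close> by simp
  obtain \<gamma>F where \<gamma>F: "gauge \<gamma>F" "\<And>D. D tagged_division_of {a..b} \<Longrightarrow> \<gamma>F fine D \<Longrightarrow>
       (\<Sum>(t,K)\<in>D. \<bar>F (Sup K) - F (Inf K) - measure lborel K * u t\<bar>) < e / (4 * M)"
    using Henstock_lemma_primitive[OF F \<open>a \<le> b\<close> \<open>e / (4 * M) > 0\<close>] by blast
  obtain \<gamma>G where \<gamma>G: "gauge \<gamma>G" "\<And>D. D tagged_division_of {a..b} \<Longrightarrow> \<gamma>G fine D \<Longrightarrow>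
       (\<Sum>(t,K)\<in>D. \<bar>G (Sup K) - G (Inf K) - measure lborel K * v t\<bar>) < e / (4 * M)"
    using Henstock_lemma_primitive[OF G \<open>a \<le> b\<close> \<open>e / (4 * M) > 0\<close>] by blast
  \<comment> \<open>The radius depends on the point through \<open>k\<close>, which will be
    \<open>u t\<close> or \<open>v t\<close>. These values may be unbounded, so no single radius
    would do. Dividing by \<open>\<bar>k\<bar> + 1\<close> covers \<open>k = 0\<close>.\<close>
  have near: "\<exists>r>0. \<forall>y\<in>{a..b}. dist y t < r \<longrightarrow> \<bar>k\<bar> * \<bar>H y - H t\<bar> \<le> \<eta>"
    if H: "continuous_on {a..b} H" "t \<in> {a..b}" for H :: "real \<Rightarrow> real" and k t
  proof -
    have "\<eta> / (\<bar>k\<bar> + 1) > 0"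
      using \<open>\<eta> > 0\<close> by (simp add: add_nonneg_pos)
    then obtain r where "r > 0" and r: "\<forall>y\<in>{a..b}. dist y t < r \<longrightarrow> dist (H y) (H t) < \<eta> / (\<bar>k\<bar> + 1)"
      using H unfolding continuous_on_iff by metis
    have "\<bar>k\<bar> * \<bar>H y - H t\<bar> \<le> \<eta>" if "y \<in> {a..b}" "dist y t < r" for y
    proof -
      have "\<bar>k\<bar> * \<bar>H y - H t\<bar> \<le> (\<bar>k\<bar> + 1) * \<bar>H y - H t\<bar>"
        by (intro mult_right_mono) auto
      also have "\<dots> < \<eta>"
        using r that by (simp add: dist_real_def pos_less_divide_eq add_nonneg_pos mult.commute)
      finally show ?thesis by simp
    qed
    with \<open>r > 0\<close> show ?thesis by blast
  qed
  \<comment> \<open>A gauge is defined on the whole line, so a positive radius is chosen outside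
    \<open>{a..b}\<close> too.\<close>
  have "\<forall>t. \<exists>r>0. t \<in> {a..b} \<longrightarrow> (\<forall>y\<in>{a..b}. dist y t < r \<longrightarrow>
      \<bar>u t\<bar> * \<bar>G y - G t\<bar> \<le> \<eta> \<and> \<bar>v t\<bar> * \<bar>F y - F t\<bar> \<le> \<eta>)"
  proof
    fix t
    show "\<exists>r>0. t \<in> {a..b} \<longrightarrow> (\<forall>y\<in>{a..b}. dist y t < r \<longrightarrow>
      \<bar>u t\<bar> * \<bar>G y - G t\<bar> \<le> \<eta> \<and> \<bar>v t\<bar> * \<bar>F y - F t\<bar> \<le> \<eta>)"
    proof (cases "t \<in> {a..b}")
      case True
      obtain r s where "r > 0" "s > 0"
        "\<forall>y\<in>{a..b}. dist y t < r \<longrightarrow> \<bar>u t\<bar> * \<bar>G y - G t\<bar> \<le> \<eta>"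
        "\<forall>y\<in>{a..b}. dist y t < s \<longrightarrow> \<bar>v t\<bar> * \<bar>F y - F t\<bar> \<le> \<eta>"
        using near[OF contG True, of "u t"] near[OF contF True, of "v t"] by blast
      then show ?thesis
        by (intro exI[of _ "min r s"]) auto
    qed (auto intro: exI[of _ 1])
  qed
  then obtain r where r: "\<And>t. r t > 0"
    "\<And>t y. t \<in> {a..b} \<Longrightarrow> y \<in> {a..b} \<Longrightarrow> dist y t < r t \<Longrightarrow>
       \<bar>u t\<bar> * \<bar>G y - G t\<bar> \<le> \<eta> \<and> \<bar>v t\<bar> * \<bar>F y - F t\<bar> \<le> \<eta>"
    by metis
  define \<gamma> where "\<gamma> = (\<lambda>t. \<gamma>F t \<inter> \<gamma>G t \<inter> ball t (r t))"
  have "gauge \<gamma>"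
    unfolding \<gamma>_def using \<gamma>F(1) \<gamma>G(1) r(1) by (intro gauge_Int gauge_ball_dependent) auto
  moreover have "norm ((\<Sum>(t,K)\<in>D. measure lborel K *\<^sub>R (u t * G t + F t * v t)) - (F b * G b - F a * G a)) < e"
    if D: "D tagged_division_of {a..b}" and "\<gamma> fine D" for D
  proof -
    have fine: "\<gamma>F fine D" "\<gamma>G fine D" "(\<lambda>t. ball t (r t)) fine D"
      using \<open>\<gamma> fine D\<close> by (auto simp: \<gamma>_def fine_Int)
    define EF where "EF = (\<lambda>(t,K). \<bar>F (Sup K) - F (Inf K) - measure lborel K * u t\<bar>)"
    define EG where "EG = (\<lambda>(t,K). \<bar>G (Sup K) - G (Inf K) - measure lborel K * v t\<bar>)"
    \<comment> \<open>The local error on one tagged piece. Summed over \<open>D\<close>, the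
      increments of \<open>F G\<close> telescope, which leaves the error of the whole Riemann
      sum.\<close>
    define \<Delta> where "\<Delta> = (\<lambda>(t,K). measure lborel K * (u t * G t + F t * v t)
                            - (F (Sup K) * G (Sup K) - F (Inf K) * G (Inf K)))"
    have bound: "\<bar>\<Delta> p\<bar> \<le> M * EF p + M * EG p + 2 * \<eta> * measure lborel (snd p)" if "p \<in> D" for p
    proof -
      obtain t K where p: "p = (t, K)" by fastforce
      have tK: "(t, K) \<in> D" using that p by simp
      obtain c d where K: "K = {c..d}"
        using tagged_division_ofD(4)[OF D tK] by auto
      have "t \<in> K" "K \<subseteq> {a..b}"
        using tagged_division_ofD(2,3)[OF D tK] by auto
      then have "c \<le> d" and mem: "t \<in> {a..b}" "c \<in> {a..b}" "d \<in> {a..b}"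
        using K by auto
      \<comment> \<open>Fineness puts both endpoints of the piece, where \<open>G d\<close> and
        \<open>F c\<close> are taken, within \<open>r t\<close> of the tag.\<close>
      have "K \<subseteq> ball t (r t)"
        using fine(3) tK by (auto simp: fine_def)
      then have "dist c t < r t" "dist d t < r t"
        using K \<open>c \<le> d\<close> by (auto simp: dist_commute)
      then have close: "\<bar>u t * (G d - G t)\<bar> \<le> \<eta>" "\<bar>v t * (F c - F t)\<bar> \<le> \<eta>"
        using r(2) mem by (auto simp: abs_mult)
      define x where "x = F d - F c - (d - c) * u t"
      define y where "y = G d - G c - (d - c) * v t"
      have "(d - c) * (u t * G t + F t * v t) - (F d * G d - F c * G c) =
            - (x * G d) - F c * y - (d - c) * (u t * (G d - G t)) - (d - c) * (v t * (F c - F t))"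
        by (simp add: x_def y_def algebra_simps)
      moreover have "\<bar>x * G d\<bar> \<le> M * \<bar>x\<bar>" "\<bar>F c * y\<bar> \<le> M * \<bar>y\<bar>"
        using M mem by (auto simp: abs_mult mult.commute[of "\<bar>x\<bar>"] intro!: mult_right_mono)
      moreover have "\<bar>(d - c) * (u t * (G d - G t))\<bar> \<le> (d - c) * \<eta>"
        "\<bar>(d - c) * (v t * (F c - F t))\<bar> \<le> (d - c) * \<eta>"
        using close \<open>c \<le> d\<close> by (auto simp: abs_mult[of "d - c"] intro!: mult_left_mono)
      ultimately have "\<bar>(d - c) * (u t * G t + F t * v t) - (F d * G d - F c * G c)\<bar> \<le>
          M * \<bar>x\<bar> + M * \<bar>y\<bar> + 2 * ((d - c) * \<eta>)"
        by linarith
      then show ?thesis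
        using K \<open>c \<le> d\<close> by (simp add: p \<Delta>_def EF_def EG_def x_def y_def mult_ac)
    qed
    have "(\<Sum>p\<in>D. measure lborel (snd p)) = b - a"
      using additive_content_tagged_division[of D a b] D \<open>a \<le> b\<close> by (simp add: case_prod_unfold)
    then have "(\<Sum>p\<in>D. M * EF p + M * EG p + 2 * \<eta> * measure lborel (snd p)) =
        M * sum EF D + M * sum EG D + 2 * \<eta> * (b - a)"
      by (simp add: sum.distrib flip: sum_distrib_left)
    also have "\<dots> < M * (e / (4 * M)) + M * (e / (4 * M)) + 2 * \<eta> * (b - a + 1)"
    proof -
      have "sum EF D < e / (4 * M)" "sum EG D < e / (4 * M)"
        using \<gamma>F(2)[OF D fine(1)] \<gamma>G(2)[OF D fine(2)] by (simp_all add: EF_def EG_def)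
      then have "M * sum EF D < M * (e / (4 * M))" "M * sum EG D < M * (e / (4 * M))"
        using \<open>M > 0\<close> by (simp_all only: mult_strict_left_mono)
      moreover have "2 * \<eta> * (b - a) < 2 * \<eta> * (b - a + 1)"
        using \<open>\<eta> > 0\<close> by simp
      ultimately show ?thesis by linarith
    qed
    also have "\<dots> = e"
    proof -
      have "4 * (b - a + 1) \<noteq> 0" using \<open>a \<le> b\<close> by simp
      then have "\<eta> * (4 * (b - a + 1)) = e"
        unfolding \<eta>_def times_divide_eq_left by (rule nonzero_mult_div_cancel_right)
      moreover have "M * (e / (4 * M)) = e / 4"
        using \<open>M > 0\<close> by simp
      ultimately show ?thesis
        by (simp add: algebra_simps)
    qed
    finally have "\<bar>sum \<Delta> D\<bar> < e"
      using sum_abs[of \<Delta> D] sum_mono[of D "\<lambda>p. \<bar>\<Delta> p\<bar>", OF bound] by linarith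
    moreover have "sum \<Delta> D =
        (\<Sum>(t,K)\<in>D. measure lborel K *\<^sub>R (u t * G t + F t * v t)) - (F b * G b - F a * G a)"
      using additive_tagged_division_1[OF \<open>a \<le> b\<close> D, of "\<lambda>x. F x * G x"]
      by (simp add: \<Delta>_def case_prod_unfold sum_subtractf)
    ultimately show ?thesis by simp
  qed
  ultimately show "\<exists>\<gamma>. gauge \<gamma> \<and> (\<forall>D. D tagged_division_of {a..b} \<and> \<gamma> fine D \<longrightarrow>
      norm ((\<Sum>(t,K)\<in>D. measure lborel K *\<^sub>R (u t * G t + F t * v t)) - (F b * G b - F a * G a)) < e)"
    by (intro exI[of _ \<gamma>] conjI allI impI) simp_all
qed

text \<open>Subtracting or adding the difference carries \<open>has_integral\<close> from one
  function to the other with the same value. If neither function is integrable, both integrals take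
  the default value 0.\<close>

lemma integral_eq_if_has_integral_diff_0:
  fixes f g :: "'a::euclidean_space \<Rightarrow> 'b::real_normed_vector"
  assumes "((\<lambda>x. f x - g x) has_integral 0) S"
  shows "integral S f = integral S g"
proof -
  have "(f has_integral y) S \<longleftrightarrow> (g has_integral y) S" for y
    using has_integral_add[OF assms, of g y] has_integral_diff[OF _ assms, of f y] by auto
  then show ?thesis
    by (simp add: integral_def integrable_on_def)
qed

theorem proposition3p2:
  fixes f g :: "real \<Rightarrow> real" and a b \<alpha> :: real
  assumes "a \<le> b" and "0 < \<alpha>" and "\<alpha> \<le> 1"
    and "\<And>t. t \<in> {a..b} \<Longrightarrow> (\<lambda>x. (x - a) powr (\<alpha> - 1) * f x) integrable_on {a..t}"
    and "\<And>t. t \<in> {a..b} \<Longrightarrow> (\<lambda>x. (b - x) powr (\<alpha> - 1) * g x) integrable_on {t..b}"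
  shows "integral {a..b} (\<lambda>t. left_conf_integral \<alpha> a f t * g t * (b - t) powr (\<alpha> - 1)) =
         integral {a..b} (\<lambda>t. f t * right_conf_integral \<alpha> b g t * (t - a) powr (\<alpha> - 1))"
proof -
  define u where "u = (\<lambda>x. (x - a) powr (\<alpha> - 1) * f x)"
  define v where "v = (\<lambda>x. (b - x) powr (\<alpha> - 1) * g x)"
  define F where "F = left_conf_integral \<alpha> a f"
  define G where "G = right_conf_integral \<alpha> b g"
  have F_eq: "F t = integral {a..t} u" and G_eq: "G t = integral {t..b} v" for t
    by (simp_all add: F_def G_def u_def v_def left_conf_integral_def right_conf_integral_def)
  have u: "u integrable_on {a..t}" and v: "v integrable_on {t..b}" if "t \<in> {a..b}" for t
    using assms(4,5) that by (auto simp: u_def v_def)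
  have "(u has_integral F y - F x) {x..y}" if "a \<le> x" "x \<le> y" "y \<le> b" for x y
  proof -
    have "integral {a..x} u + integral {x..y} u = integral {a..y} u"
      using that u by (intro Henstock_Kurzweil_Integration.integral_combine) auto
    moreover have "u integrable_on {x..y}"
      using that by (intro integrable_subinterval_real[OF u[of y]]) auto
    ultimately show ?thesis
      by (simp add: F_eq has_integral_iff)
  qed
  \<comment> \<open>The variable of \<open>G\<close> is the lower limit of integration, so
    \<open>G\<close> is a primitive of \<open>- v\<close>.\<close>
  moreover have "((\<lambda>t. - v t) has_integral G y - G x) {x..y}" if "a \<le> x" "x \<le> y" "y \<le> b" for x y
  proof -
    have "integral {x..y} v + integral {y..b} v = integral {x..b} v"
      using that v by (intro Henstock_Kurzweil_Integration.integral_combine) auto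
    moreover have "v integrable_on {x..y}"
      using that by (intro integrable_subinterval_real[OF v[of x]]) auto
    ultimately show ?thesis
      by (simp add: G_eq has_integral_iff integrable_neg)
  qed
  ultimately have "((\<lambda>t. u t * G t + F t * - v t) has_integral F b * G b - F a * G a) {a..b}"
    using \<open>a \<le> b\<close> by (intro has_integral_by_parts_primitives)
  \<comment> \<open>The boundary terms vanish because \<open>G b\<close> and \<open>F a\<close> are
    integrals over a single point.\<close>
  then have "((\<lambda>t. u t * G t - F t * v t) has_integral 0) {a..b}"
    by (simp add: F_eq G_eq)
  then have "integral {a..b} (\<lambda>t. u t * G t) = integral {a..b} (\<lambda>t. F t * v t)"
    by (rule integral_eq_if_has_integral_diff_0)
  then show ?thesis
    by (simp add: u_def v_def mult_ac flip: F_def G_def)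
qed

end
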